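(* Let $n\geq 1$ and let $k$ be a domain. Let $F=(f_1,\ldots,f_n)\in\mathrm{Aut}_k\,k[\mathbf{x}]$ and $\mathbf{w}=(w_1,\ldots,w_n)\in\Gamma^n$ be such that $\deg_{\mathbf{w}}F>|\mathbf{w}|$. Then there exists $1\leq i\leq n$ such that $\deg_{\mathbf{w}}f_j$ belongs to $\sum_{l\neq i}\mathbb{Z}_{\geq 0}w_l$ for $j=1,\ldots,n$.
   Context: $k[\mathbf{x}]=k[x_1,\ldots,x_n]$ is the polynomial ring in $n$ variables over $k$, and $\mathrm{Aut}_k\,k[\mathbf{x}]$ is the group of $k$-algebra automorphisms; $F=(f_1,\ldots,f_n)$ means $f_i=F(x_i)$. $\Gamma$ is a totally ordered additive group, i.e. an additive (abelian) group with a total ordering such that $\alpha\leq\beta$ implies $\alpha+\gamma\leq\beta+\gamma$. For $\mathbf{w}\in\Gamma^n$ and nonzero $f\in k[\mathbf{x}]$, $\deg_{\mathbf{w}}f$ is the maximum of $\sum_i a_iw_i$ over the monomials $x_1^{a_1}\cdots x_n^{a_n}$ appearing in $f$ with nonzero coefficient. $\deg_{\mathbf{w}}F=\sum_{i=1}^n\deg_{\mathbf{w}}f_i$ and $|\mathbf{w}|=w_1+\cdots+w_n$. $\sum_{l\neq i}\mathbb{Z}_{\geq 0}w_l$ is the set of sums $\sum_{l\neq i}a_lw_l$ with $a_l\in\mathbb{Z}_{\geq 0}$ (equal to $\{0\}$ if $n=1$). *)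

theory Defs
  imports Complex_Main "HOL-Library.Poly_Mapping"
begin

text \<open>
  The polynomial ring \<open>k[x\<^sub>1, \<dots>, x\<^sub>n]\<close> is the monoid algebra over \<open>k\<close> of the free commutative
  monoid on a finite index type \<open>'n\<close>, so that \<open>n\<close> is the cardinality of \<open>'n\<close>. A monomial is its
  exponent vector.
\<close>

type_synonym ('n, 'k) mpoly = "('n \<Rightarrow>\<^sub>0 nat) \<Rightarrow>\<^sub>0 'k"

definition mconst :: "'k \<Rightarrow> ('n, 'k::comm_ring_1) mpoly" where
  "mconst c = Poly_Mapping.single 0 c"

definition mvar :: "'n \<Rightarrow> ('n, 'k::comm_ring_1) mpoly" where
  "mvar i = Poly_Mapping.single (Poly_Mapping.single i 1) 1"

definition algebra_automorphism ::
    "(('n, 'k::comm_ring_1) mpoly \<Rightarrow> ('n, 'k) mpoly) \<Rightarrow> bool" where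
  "algebra_automorphism F \<longleftrightarrow>
     bij F \<and>
     (\<forall>p q. F (p + q) = F p + F q) \<and>
     (\<forall>p q. F (p * q) = F p * F q) \<and>
     (\<forall>c. F (mconst c) = mconst c)"

definition nat_scale :: "nat \<Rightarrow> 'g::comm_monoid_add \<Rightarrow> 'g" where
  "nat_scale m g = (\<Sum>_<m. g)"

definition wdeg_monomial ::
    "('n::finite \<Rightarrow> 'g::comm_monoid_add) \<Rightarrow> ('n \<Rightarrow>\<^sub>0 nat) \<Rightarrow> 'g" where
  "wdeg_monomial w a = (\<Sum>i\<in>UNIV. nat_scale (Poly_Mapping.lookup a i) (w i))"

text \<open>Meaningful for nonzero \<open>f\<close> only: the value at \<open>0\<close> is the unspecified \<open>Max {}\<close>.\<close>

definition wdeg ::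
    "('n::finite \<Rightarrow> 'g::linordered_ab_group_add) \<Rightarrow> ('n, 'k::comm_ring_1) mpoly \<Rightarrow> 'g" where
  "wdeg w f = Max (wdeg_monomial w ` Poly_Mapping.keys f)"

text \<open>The degree of \<open>F = (f\<^sub>1, \<dots>, f\<^sub>n)\<close>, where \<open>f\<^sub>i\<close> is the image of the \<open>i\<close>-th variable.\<close>

definition wdeg_map ::
    "('n::finite \<Rightarrow> 'g::linordered_ab_group_add) \<Rightarrow>
     (('n, 'k::comm_ring_1) mpoly \<Rightarrow> ('n, 'k) mpoly) \<Rightarrow> 'g" where
  "wdeg_map w F = (\<Sum>i\<in>UNIV. wdeg w (F (mvar i)))"

definition nat_span_except ::
    "('n::finite \<Rightarrow> 'g::comm_monoid_add) \<Rightarrow> 'n \<Rightarrow> 'g set" where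
  "nat_span_except w i = {(\<Sum>l\<in>UNIV - {i}. nat_scale (a l) (w l)) |a :: 'n \<Rightarrow> nat. True}"

end

theory Submission
  imports Defs
begin

text \<open>
  Write \<open>f\<^sub>j\<close> for the image of \<open>x\<^sub>j\<close> and \<open>f\<^sub>j\<^sup>w\<close> for its homogeneous part of highest weighted degree.
  If the degree of \<open>f\<^sub>j\<close> is not a combination of the weights other than \<open>w\<^sub>l\<close>, then every monomial
  of \<open>f\<^sub>j\<^sup>w\<close> contains \<open>x\<^sub>l\<close>, so \<open>x\<^sub>l\<close> divides \<open>f\<^sub>j\<^sup>w\<close>. The proof studies these divisors by means of
  an action of the additive group, in a form that works in every characteristic.

  Fix \<open>i\<close>. Since \<open>f\<^sub>1, \<dots>, f\<^sub>n\<close> are coordinates, there is an algebra homomorphism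
  \<open>E : k[x] \<rightarrow> k[x][t]\<close> with \<open>E f\<^sub>i = f\<^sub>i + t\<close> and \<open>E f\<^sub>j = f\<^sub>j\<close> for \<open>j \<noteq> i\<close>; at \<open>t = 0\<close> it is the
  inclusion. Give \<open>t\<close> the largest weight for which \<open>E\<close> raises no degrees. Taking
  leading parts of the \<open>E x\<^sub>l\<close> then yields a homomorphism \<open>\<phi>\<close> which is still the inclusion at
  \<open>t = 0\<close>, but which moves some variable \<open>x\<^sub>l\<close>, by maximality of the weight of \<open>t\<close>. It fixes
  \<open>f\<^sub>j\<^sup>w\<close> for \<open>j \<noteq> i\<close>, and sends \<open>f\<^sub>i\<^sup>w\<close> to itself or to \<open>f\<^sub>i\<^sup>w + t\<close> (\<open>translation_degeneration\<close>).

  Degrees in \<open>t\<close> are additive, because the polynomial ring is a domain (\<open>mpoly_mult_nonzero\<close>). Hence a factor of a nonzero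
  polynomial fixed by \<open>\<phi>\<close> is fixed by \<open>\<phi>\<close> (\<open>deformation_trivial_on_factor\<close>), and therefore
  \<open>x\<^sub>l\<close> divides no \<open>f\<^sub>j\<^sup>w\<close> with \<open>j \<noteq> i\<close>. If \<open>x\<^sub>l\<close> divides \<open>f\<^sub>i\<^sup>w\<close>, then \<open>\<phi>\<close> must send \<open>f\<^sub>i\<^sup>w\<close> to
  \<open>f\<^sub>i\<^sup>w + t\<close>, which is linear in \<open>t\<close>. So \<open>\<phi> x\<^sub>l\<close> is linear in \<open>t\<close>, the cofactor is free of \<open>t\<close>, and
  comparing coefficients of \<open>t\<close> shows that the cofactor divides \<open>1\<close>; thus \<open>f\<^sub>i\<^sup>w\<close> is a constant
  times \<open>x\<^sub>l\<close> (\<open>deformation_cofactor_constant\<close>).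

  Now suppose that for each \<open>l\<close> some \<open>f\<^sub>j\<close> has a degree outside the span of the weights other than
  \<open>w\<^sub>l\<close>. For the variable attached to \<open>i\<close> as above, this \<open>f\<^sub>j\<close> can only be \<open>f\<^sub>i\<close>. Hence the map
  \<open>\<sigma>\<close> from \<open>i\<close> to the index of its variable is injective, so a permutation, and the degree of
  \<open>f\<^sub>i\<close> is the weight of that variable. Summing over \<open>i\<close>, the degree of the automorphism is
  the sum of the weights, contrary to hypothesis.
\<close>

section \<open>Multiples in an ordered group\<close>

lemma nat_scale_0 [simp]: "nat_scale 0 g = 0"
  by (simp add: nat_scale_def)

lemma nat_scale_Suc [simp]: "nat_scale (Suc m) g = g + nat_scale m g"
  by (simp add: nat_scale_def add.commute)

lemma nat_scale_zero [simp]: "nat_scale m 0 = 0"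
  by (simp add: nat_scale_def)

lemma nat_scale_add_left: "nat_scale (m + n) g = nat_scale m g + nat_scale n g"
  by (induction m) (simp_all add: add.assoc)

lemma nat_scale_add_right: "nat_scale m (g + h) = nat_scale m g + nat_scale m h"
  by (simp add: nat_scale_def sum.distrib)

lemma nat_scale_mult: "nat_scale (m * n) g = nat_scale m (nat_scale n g)"
  by (induction m) (simp_all add: nat_scale_add_left)

lemma nat_scale_left_commute: "nat_scale m (nat_scale n g) = nat_scale n (nat_scale m g)"
  by (metis nat_scale_mult mult.commute)

lemma nat_scale_sum: "nat_scale m (sum f I) = (\<Sum>i\<in>I. nat_scale m (f i))"
  unfolding nat_scale_def by (rule sum.swap)

lemma nat_scale_minus: "nat_scale m (- g) = - nat_scale m (g :: 'g::linordered_ab_group_add)"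
  by (simp add: nat_scale_def sum_negf)

lemma nat_scale_int [simp]: "nat_scale m (g :: int) = int m * g"
  by (simp add: nat_scale_def)

lemma nat_scale_mono:
  fixes g h :: "'g::linordered_ab_group_add"
  shows "g \<le> h \<Longrightarrow> nat_scale m g \<le> nat_scale m h"
  by (simp add: nat_scale_def sum_mono)

lemma nat_scale_strict_mono:
  fixes g h :: "'g::linordered_ab_group_add"
  shows "g < h \<Longrightarrow> 0 < m \<Longrightarrow> nat_scale m g < nat_scale m h"
  unfolding nat_scale_def by (rule sum_strict_mono) auto

lemma nat_scale_le_iff:
  fixes g h :: "'g::linordered_ab_group_add"
  shows "0 < m \<Longrightarrow> nat_scale m g \<le> nat_scale m h \<longleftrightarrow> g \<le> h"
  by (meson nat_scale_mono nat_scale_strict_mono not_le)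

lemma nat_scale_eq_iff:
  fixes g h :: "'g::linordered_ab_group_add"
  shows "0 < m \<Longrightarrow> nat_scale m g = nat_scale m h \<longleftrightarrow> g = h"
  by (simp add: order.eq_iff nat_scale_le_iff)

text \<open>
  Reading \<open>(u, m)\<close> as the fraction \<open>u / m\<close>, a finite nonempty set of fractions has a minimum. The
  group need not be divisible, so fractions are compared by cross-multiplication.
\<close>

lemma finite_fractions_minimal:
  fixes S :: "('g::linordered_ab_group_add \<times> nat) set"
  assumes "finite S" "S \<noteq> {}" "\<And>u m. (u, m) \<in> S \<Longrightarrow> 0 < m"
  shows "\<exists>(u, m)\<in>S. \<forall>(u', m')\<in>S. nat_scale m' u \<le> nat_scale m u'"
  using assms
proof (induction S rule: finite_ne_induct)
  case (singleton x)
  then show ?case by (cases x) auto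
next
  case (insert x S)
  obtain y n where x: "x = (y, n)" by (cases x)
  obtain u m where um: "(u, m) \<in> S" and
    min: "\<And>u' m'. (u', m') \<in> S \<Longrightarrow> nat_scale m' u \<le> nat_scale m u'"
    using insert.IH insert.prems by fastforce
  have pos: "0 < m" "0 < n" using um insert.prems x by auto
  show ?case
  proof (cases "nat_scale n u \<le> nat_scale m y")
    case True
    then show ?thesis using um min x by (intro bexI[of _ "(u, m)"]) auto
  next
    case False
    have "nat_scale m' y \<le> nat_scale n u'" if "(u', m') \<in> S" for u' m'
    proof -
      have "nat_scale m (nat_scale m' y) = nat_scale m' (nat_scale m y)"
        by (rule nat_scale_left_commute)
      also have "\<dots> \<le> nat_scale m' (nat_scale n u)"
        using False by (intro nat_scale_mono) simp
      also have "\<dots> = nat_scale n (nat_scale m' u)"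
        by (rule nat_scale_left_commute)
      also have "\<dots> \<le> nat_scale n (nat_scale m u')"
        by (intro nat_scale_mono min that)
      also have "\<dots> = nat_scale m (nat_scale n u')"
        by (rule nat_scale_left_commute)
      finally show ?thesis using pos nat_scale_le_iff by blast
    qed
    then show ?thesis using x by (intro bexI[of _ "(y, n)"]) auto
  qed
qed

section \<open>Weighted degrees and homogeneous parts\<close>

lemma wdeg_monomial_zero [simp]: "wdeg_monomial w 0 = 0"
  by (simp add: wdeg_monomial_def)

lemma wdeg_monomial_add: "wdeg_monomial w (a + b) = wdeg_monomial w a + wdeg_monomial w b"
  by (simp add: wdeg_monomial_def lookup_add nat_scale_add_left sum.distrib)

lemma wdeg_monomial_single [simp]:
  "wdeg_monomial w (Poly_Mapping.single i m) = nat_scale m (w i)"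
proof -
  have "nat_scale (Poly_Mapping.lookup (Poly_Mapping.single i m) j) (w j)
      = (if j = i then nat_scale m (w i) else 0)" for j
    by (simp add: lookup_single when_def)
  then show ?thesis by (simp add: wdeg_monomial_def)
qed

lemma wdeg_monomial_nat_scale:
  "wdeg_monomial (\<lambda>i. nat_scale m (w i)) a = nat_scale m (wdeg_monomial w a)"
  by (simp add: wdeg_monomial_def nat_scale_sum nat_scale_left_commute[of _ m])

lemma wdeg_monomial_uminus:
  fixes v :: "'n::finite \<Rightarrow> 'g::linordered_ab_group_add"
  shows "wdeg_monomial (\<lambda>i. - v i) a = - wdeg_monomial v a"
  by (simp add: wdeg_monomial_def nat_scale_minus sum_negf)

lemma wdeg_monomial_nonneg:
  fixes v :: "'n::finite \<Rightarrow> 'g::linordered_ab_group_add"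
  assumes "\<And>i. 0 \<le> v i"
  shows "0 \<le> wdeg_monomial v a"
  using assms by (auto simp: wdeg_monomial_def nat_scale_def intro!: sum_nonneg)

lemma wdeg_monomial_of_bool:
  "wdeg_monomial (\<lambda>j. of_bool (j = i)) a = int (Poly_Mapping.lookup a i)"
  by (simp add: wdeg_monomial_def of_bool_def if_distrib cong: if_cong)

definition wdeg_at_most ::
    "('n::finite \<Rightarrow> 'g::linordered_ab_group_add) \<Rightarrow> 'g \<Rightarrow> ('n, 'k::comm_ring_1) mpoly \<Rightarrow> bool" where
  "wdeg_at_most w d p \<longleftrightarrow> (\<forall>a\<in>Poly_Mapping.keys p. wdeg_monomial w a \<le> d)"

definition homog_part ::
    "('n::finite \<Rightarrow> 'g::linordered_ab_group_add) \<Rightarrow> 'g \<Rightarrow> ('n, 'k::comm_ring_1) mpoly \<Rightarrow> ('n, 'k) mpoly" where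
  "homog_part w d p = Poly_Mapping.mapp (\<lambda>a c. c when wdeg_monomial w a = d) p"

lemma lookup_homog_part:
  "Poly_Mapping.lookup (homog_part w d p) a = (Poly_Mapping.lookup p a when wdeg_monomial w a = d)"
  by (simp add: homog_part_def lookup_mapp when_def in_keys_iff)

lemma keys_homog_part:
  "Poly_Mapping.keys (homog_part w d p) = {a \<in> Poly_Mapping.keys p. wdeg_monomial w a = d}"
  by (auto simp: in_keys_iff lookup_homog_part)

lemma homog_part_zero [simp]: "homog_part w d 0 = 0"
  by (rule poly_mapping_eqI) (simp add: lookup_homog_part)

lemma homog_part_add: "homog_part w d (p + q) = homog_part w d p + homog_part w d q"
  by (rule poly_mapping_eqI) (simp add: lookup_homog_part lookup_add when_add_distrib)

lemma homog_part_sum: "homog_part w d (sum f I) = (\<Sum>i\<in>I. homog_part w d (f i))"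
  by (induction I rule: infinite_finite_induct) (simp_all add: homog_part_add)

lemma homog_part_commute:
  "homog_part w d (homog_part v e p) = homog_part v e (homog_part w d p)"
  by (rule poly_mapping_eqI) (simp add: lookup_homog_part when_def)

lemma homog_part_eq_self:
  "(\<And>a. a \<in> Poly_Mapping.keys p \<Longrightarrow> wdeg_monomial w a = d) \<Longrightarrow> homog_part w d p = p"
  by (rule poly_mapping_eqI) (auto simp: lookup_homog_part when_def in_keys_iff)

lemma homog_part_eq_0:
  "(\<And>a. a \<in> Poly_Mapping.keys p \<Longrightarrow> wdeg_monomial w a \<noteq> d) \<Longrightarrow> homog_part w d p = 0"
  by (rule poly_mapping_eqI) (auto simp: lookup_homog_part when_def in_keys_iff)

lemma homog_part_0_eq_self:
  fixes v :: "'n::finite \<Rightarrow> 'g::linordered_ab_group_add"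
  assumes "\<And>i. 0 \<le> v i" "wdeg_at_most v 0 p"
  shows "homog_part v 0 p = p"
  using assms wdeg_monomial_nonneg[of v, OF assms(1)]
  by (intro homog_part_eq_self) (auto simp: wdeg_at_most_def intro: antisym)

lemma wdeg_at_most_add:
  "wdeg_at_most w d p \<Longrightarrow> wdeg_at_most w d q \<Longrightarrow> wdeg_at_most w d (p + q)"
  unfolding wdeg_at_most_def using keys_add[of p q] by blast

lemma wdeg_at_most_zero [simp]: "wdeg_at_most w d 0"
  by (simp add: wdeg_at_most_def)

lemma wdeg_at_most_sum:
  "(\<And>i. i \<in> I \<Longrightarrow> wdeg_at_most w d (f i)) \<Longrightarrow> wdeg_at_most w d (sum f I)"
  by (induction I rule: infinite_finite_induct) (simp_all add: wdeg_at_most_add)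

lemma wdeg_at_most_mult:
  assumes "wdeg_at_most w d p" "wdeg_at_most w e q"
  shows "wdeg_at_most w (d + e) (p * q)"
  using assms keys_mult[of p q]
  unfolding wdeg_at_most_def by (fastforce simp: wdeg_monomial_add intro: add_mono)

text \<open>
  A product of monomials reaches the degree bound \<open>d + e\<close> only if both factors reach theirs.
\<close>

lemma homog_part_mult:
  fixes p q :: "('n::finite, 'k::comm_ring_1) mpoly"
  assumes p: "wdeg_at_most w d p" and q: "wdeg_at_most w e q"
  shows "homog_part w (d + e) (p * q) = homog_part w d p * homog_part w e q"
proof -
  define p' q' where "p' = p - homog_part w d p" and "q' = q - homog_part w e q"
  have lower: "a \<in> Poly_Mapping.keys (r - homog_part w c r) \<Longrightarrow> wdeg_monomial w a < c"
    if "wdeg_at_most w c r" for a c and r :: "('n, 'k) mpoly"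
    using that unfolding wdeg_at_most_def
    by (auto simp: in_keys_iff lookup_minus lookup_homog_part when_def order.strict_iff_order split: if_splits)
  have p': "\<And>a. a \<in> Poly_Mapping.keys p' \<Longrightarrow> wdeg_monomial w a < d"
    and q': "\<And>a. a \<in> Poly_Mapping.keys q' \<Longrightarrow> wdeg_monomial w a < e"
    using lower p q by (auto simp: p'_def q'_def)
  have "p * q = homog_part w d p * homog_part w e q + (homog_part w d p * q' + p' * q)"
    by (simp add: p'_def q'_def algebra_simps)
  moreover have "homog_part w (d + e) (homog_part w d p * homog_part w e q)
      = homog_part w d p * homog_part w e q"
    using keys_mult[of "homog_part w d p" "homog_part w e q"]
    by (intro homog_part_eq_self) (auto simp: keys_homog_part wdeg_monomial_add)
  moreover have "homog_part w (d + e) (homog_part w d p * q') = 0"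
  proof (rule homog_part_eq_0)
    fix a assume "a \<in> Poly_Mapping.keys (homog_part w d p * q')"
    then obtain b c where "a = b + c" "wdeg_monomial w b = d" "c \<in> Poly_Mapping.keys q'"
      using keys_mult[of "homog_part w d p" q'] by (auto simp: keys_homog_part)
    then show "wdeg_monomial w a \<noteq> d + e" using q' by (force simp: wdeg_monomial_add)
  qed
  moreover have "homog_part w (d + e) (p' * q) = 0"
  proof (rule homog_part_eq_0)
    fix a assume "a \<in> Poly_Mapping.keys (p' * q)"
    then obtain b c where "a = b + c" "b \<in> Poly_Mapping.keys p'" "c \<in> Poly_Mapping.keys q"
      using keys_mult[of p' q] by auto
    then have "a = b + c" "wdeg_monomial w b < d" "wdeg_monomial w c \<le> e"
      using p' q by (auto simp: wdeg_at_most_def)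
    then show "wdeg_monomial w a \<noteq> d + e"
      using add_less_le_mono by (fastforce simp: wdeg_monomial_add)
  qed
  ultimately show ?thesis by (simp add: homog_part_add)
qed

lemma wdeg_at_most_mconst [simp]: "wdeg_at_most w 0 (mconst c)"
  by (simp add: wdeg_at_most_def mconst_def)

lemma homog_part_mconst [simp]: "homog_part w 0 (mconst c) = mconst c"
  by (rule homog_part_eq_self) (auto simp: mconst_def split: if_splits)

lemma mconst_1 [simp]: "mconst 1 = 1"
  by (simp add: mconst_def)

lemma keys_mvar [simp]:
  "Poly_Mapping.keys (mvar i :: ('n, 'k::comm_ring_1) mpoly) = {Poly_Mapping.single i 1}"
  by (simp add: mvar_def)

lemma mvar_nonzero: "mvar i \<noteq> (0 :: ('n, 'k::comm_ring_1) mpoly)"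
  by (metis keys_mvar keys_zero insert_not_empty)

lemma wdeg_at_most_mvar [simp]: "wdeg_at_most w (w i) (mvar i)"
  by (simp add: wdeg_at_most_def)

lemma homog_part_mvar: "homog_part w d (mvar i) = (if w i = d then mvar i else 0)"
  by (auto intro: homog_part_eq_self homog_part_eq_0)

lemma homog_part_power:
  assumes "wdeg_at_most w d p"
  shows "wdeg_at_most w (nat_scale m d) (p ^ m) \<and>
    homog_part w (nat_scale m d) (p ^ m) = homog_part w d p ^ m"
proof (induction m)
  case 0
  then show ?case using wdeg_at_most_mconst[of w 1] homog_part_mconst[of w 1] by simp
next
  case (Suc m)
  then show ?case using assms by (simp add: wdeg_at_most_mult homog_part_mult)
qed

lemma homog_part_prod:
  assumes "finite I" "\<And>i. i \<in> I \<Longrightarrow> wdeg_at_most w (d i) (f i)"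
  shows "wdeg_at_most w (sum d I) (prod f I) \<and>
    homog_part w (sum d I) (prod f I) = (\<Prod>i\<in>I. homog_part w (d i) (f i))"
  using assms
proof (induction I rule: finite_induct)
  case empty
  then show ?case using wdeg_at_most_mconst[of w 1] homog_part_mconst[of w 1] by simp
next
  case (insert x I)
  then show ?case by (simp add: wdeg_at_most_mult homog_part_mult)
qed

lemma wdeg_monomial_le_wdeg:
  "a \<in> Poly_Mapping.keys p \<Longrightarrow> wdeg_monomial w a \<le> wdeg w p"
  by (simp add: wdeg_def)

lemma wdeg_at_most_wdeg: "wdeg_at_most w (wdeg w p) p"
  by (simp add: wdeg_at_most_def wdeg_monomial_le_wdeg)

lemma wdeg_at_most_iff: "p \<noteq> 0 \<Longrightarrow> wdeg_at_most w d p \<longleftrightarrow> wdeg w p \<le> d"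
  by (auto simp: wdeg_at_most_def wdeg_def)

lemma homog_part_wdeg_nonzero: "p \<noteq> 0 \<Longrightarrow> homog_part w (wdeg w p) p \<noteq> 0"
proof -
  assume "p \<noteq> 0"
  then have "wdeg w p \<in> wdeg_monomial w ` Poly_Mapping.keys p"
    unfolding wdeg_def by (intro Max_in) auto
  then have "Poly_Mapping.keys (homog_part w (wdeg w p) p) \<noteq> {}"
    by (auto simp: keys_homog_part)
  then show ?thesis by auto
qed

lemma wdeg_nonneg:
  fixes v :: "'n::finite \<Rightarrow> 'g::linordered_ab_group_add" and p :: "('n, 'k::comm_ring_1) mpoly"
  assumes "\<And>i. 0 \<le> v i" "p \<noteq> 0"
  shows "0 \<le> wdeg v p"
proof -
  obtain a where "a \<in> Poly_Mapping.keys p" using assms(2) by fastforce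
  then show ?thesis
    by (rule order_trans[OF wdeg_monomial_nonneg[of v, OF assms(1)] wdeg_monomial_le_wdeg])
qed

lemma wdeg_eqI:
  assumes "wdeg_at_most w d p" "homog_part w d p \<noteq> 0"
  shows "wdeg w p = d"
proof -
  have "Poly_Mapping.keys (homog_part w d p) \<noteq> {}" using assms(2) by simp
  then obtain a where "a \<in> Poly_Mapping.keys p" "wdeg_monomial w a = d"
    by (auto simp: keys_homog_part)
  then show ?thesis
    using assms(1) unfolding wdeg_def wdeg_at_most_def by (intro Max_eqI) auto
qed

text \<open>
  The exponent vectors carry no order here, so a leading monomial is not at hand. Instead, the top
  part of a polynomial in one variable after the other isolates a single monomial; at each step the
  product of the top parts is the top part of the product, hence still zero.
\<close>

lemma mpoly_mult_nonzero:
  fixes p q :: "('n::finite, 'k::idom) mpoly"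
  assumes "p \<noteq> 0" "q \<noteq> 0"
  shows "p * q \<noteq> 0"
proof
  assume pq: "p * q = 0"
  define agree :: "'n set \<Rightarrow> ('n, 'k) mpoly \<Rightarrow> bool" where
    "agree S r \<longleftrightarrow> (\<forall>i\<in>S. \<forall>a\<in>Poly_Mapping.keys r. \<forall>b\<in>Poly_Mapping.keys r.
       Poly_Mapping.lookup a i = Poly_Mapping.lookup b i)" for S r
  have "\<exists>p' q'. p' \<noteq> 0 \<and> q' \<noteq> 0 \<and> p' * q' = 0 \<and> agree S p' \<and> agree S q'"
    if "finite S" for S
    using that
  proof (induction S rule: finite_induct)
    case empty
    then show ?case using assms pq by (auto simp: agree_def)
  next
    case (insert i S)
    then obtain p' q' where *: "p' \<noteq> 0" "q' \<noteq> 0" "p' * q' = 0" "agree S p'" "agree S q'"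
      by blast
    let ?v = "\<lambda>j. of_bool (j = i) :: int"
    let ?p = "homog_part ?v (wdeg ?v p') p'" and ?q = "homog_part ?v (wdeg ?v q') q'"
    have "?p * ?q = homog_part ?v (wdeg ?v p' + wdeg ?v q') (p' * q')"
      by (simp add: homog_part_mult wdeg_at_most_wdeg)
    then have "?p * ?q = 0" using *(3) by simp
    moreover have "?p \<noteq> 0" "?q \<noteq> 0" using *(1,2) by (simp_all add: homog_part_wdeg_nonzero)
    moreover have "agree (insert i S) (homog_part ?v d r)" if "agree S r" for d r
      unfolding agree_def
    proof (intro ballI)
      fix j a b
      assume j: "j \<in> insert i S" and "a \<in> Poly_Mapping.keys (homog_part ?v d r)"
        "b \<in> Poly_Mapping.keys (homog_part ?v d r)"
      then have ab: "a \<in> Poly_Mapping.keys r" "b \<in> Poly_Mapping.keys r"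
        "int (Poly_Mapping.lookup a i) = d" "int (Poly_Mapping.lookup b i) = d"
        by (simp_all add: keys_homog_part wdeg_monomial_of_bool)
      show "Poly_Mapping.lookup a j = Poly_Mapping.lookup b j"
      proof (cases "j = i")
        case False
        then show ?thesis using j ab(1,2) that unfolding agree_def by blast
      qed (use ab(3,4) in simp)
    qed
    ultimately show ?case using *(4,5) by blast
  qed
  then obtain p' q' where *: "p' \<noteq> 0" "q' \<noteq> 0" "p' * q' = 0" "agree UNIV p'" "agree UNIV q'"
    using finite_UNIV by blast
  have single: "\<exists>a c. c \<noteq> 0 \<and> r = Poly_Mapping.single a c"
    if nz: "r \<noteq> 0" and "agree UNIV r" for r
  proof -
    obtain a where a: "a \<in> Poly_Mapping.keys r" using nz by fastforce
    have "b = a" if "b \<in> Poly_Mapping.keys r" for b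
    proof (rule poly_mapping_eqI)
      show "Poly_Mapping.lookup b i = Poly_Mapping.lookup a i" for i
        using \<open>agree UNIV r\<close> a that unfolding agree_def by blast
    qed
    then have "r = Poly_Mapping.single a (Poly_Mapping.lookup r a)"
      by (intro poly_mapping_eqI) (auto simp: lookup_single when_def in_keys_iff)
    then show ?thesis using a by (metis in_keys_iff)
  qed
  obtain a c b d where "c \<noteq> 0" "p' = Poly_Mapping.single a c"
      "d \<noteq> 0" "q' = Poly_Mapping.single b d"
    using single[OF *(1,4)] single[OF *(2,5)] by blast
  then show False using *(3) by (metis mult_single no_zero_divisors lookup_single_eq lookup_zero)
qed

lemma wdeg_mult:
  fixes p q :: "('n::finite, 'k::idom) mpoly"
  assumes "p \<noteq> 0" "q \<noteq> 0"
  shows "wdeg w (p * q) = wdeg w p + wdeg w q"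
  using assms
  by (intro wdeg_eqI)
    (simp_all add: wdeg_at_most_mult wdeg_at_most_wdeg homog_part_mult mpoly_mult_nonzero
      homog_part_wdeg_nonzero)

section \<open>Algebra homomorphisms and substitution\<close>

definition algebra_hom ::
    "(('n, 'k::comm_ring_1) mpoly \<Rightarrow> ('m, 'k) mpoly) \<Rightarrow> bool" where
  "algebra_hom E \<longleftrightarrow>
     (\<forall>p q. E (p + q) = E p + E q) \<and>
     (\<forall>p q. E (p * q) = E p * E q) \<and>
     (\<forall>c. E (mconst c) = mconst c)"

lemma
  assumes "algebra_hom E"
  shows algebra_hom_add: "E (p + q) = E p + E q"
    and algebra_hom_mult: "E (p * q) = E p * E q"
    and algebra_hom_mconst: "E (mconst c) = mconst c"
    and algebra_hom_0: "E 0 = 0"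
    and algebra_hom_1: "E 1 = 1"
proof -
  show "E (p + q) = E p + E q" "E (p * q) = E p * E q" and c: "E (mconst c) = mconst c" for p q c
    using assms by (auto simp: algebra_hom_def)
  show "E 0 = 0" "E 1 = 1" using c[of 0] c[of 1] by (simp_all add: mconst_def)
qed

lemma algebra_hom_sum: "algebra_hom E \<Longrightarrow> E (sum f I) = (\<Sum>i\<in>I. E (f i))"
  by (induction I rule: infinite_finite_induct) (simp_all add: algebra_hom_0 algebra_hom_add)

lemma algebra_hom_prod: "algebra_hom E \<Longrightarrow> E (prod f I) = (\<Prod>i\<in>I. E (f i))"
  by (induction I rule: infinite_finite_induct) (simp_all add: algebra_hom_1 algebra_hom_mult)

lemma algebra_hom_power: "algebra_hom E \<Longrightarrow> E (p ^ m) = E p ^ m"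
  by (induction m) (simp_all add: algebra_hom_1 algebra_hom_mult)

lemma algebra_hom_comp: "algebra_hom D \<Longrightarrow> algebra_hom E \<Longrightarrow> algebra_hom (\<lambda>p. D (E p))"
  by (simp add: algebra_hom_def)

lemma mpoly_eq_sum_monomials:
  fixes p :: "('n, 'k::comm_ring_1) mpoly"
  shows "p = (\<Sum>a\<in>Poly_Mapping.keys p. Poly_Mapping.single a (Poly_Mapping.lookup p a))"
proof (rule poly_mapping_eqI)
  fix b
  have "(\<Sum>a\<in>Poly_Mapping.keys p. Poly_Mapping.lookup (Poly_Mapping.single a (Poly_Mapping.lookup p a)) b)
      = (\<Sum>a\<in>Poly_Mapping.keys p. if a = b then Poly_Mapping.lookup p b else 0)"
    by (intro sum.cong) (auto simp: lookup_single when_def)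
  also have "\<dots> = Poly_Mapping.lookup p b"
    by (simp add: sum.delta' in_keys_iff)
  finally show "Poly_Mapping.lookup p b = Poly_Mapping.lookup
      (\<Sum>a\<in>Poly_Mapping.keys p. Poly_Mapping.single a (Poly_Mapping.lookup p a)) b"
    by (simp add: lookup_sum)
qed

lemma mvar_power: "mvar i ^ m = Poly_Mapping.single (Poly_Mapping.single i m) 1"
proof (induction m)
  case (Suc m)
  have "Poly_Mapping.single i 1 + Poly_Mapping.single i m = Poly_Mapping.single i (Suc m)"
    by (simp flip: single_add)
  then show ?case using Suc by (simp add: mvar_def mult_single)
qed simp

lemma monomial_eq_prod:
  fixes c :: "'k::comm_ring_1" and a :: "'n::finite \<Rightarrow>\<^sub>0 nat"
  shows "Poly_Mapping.single a c = mconst c * (\<Prod>i\<in>UNIV. mvar i ^ Poly_Mapping.lookup a i)"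
proof -
  have prod: "(\<Prod>i\<in>I. Poly_Mapping.single (f i) 1) = Poly_Mapping.single (sum f I) (1::'k)"
    if "finite I" for I :: "'n set" and f :: "'n \<Rightarrow> 'n \<Rightarrow>\<^sub>0 nat"
    using that by (induction I rule: finite_induct) (simp_all add: mult_single)
  have "(\<Sum>i\<in>UNIV. Poly_Mapping.single i (Poly_Mapping.lookup a i)) = a"
  proof (rule poly_mapping_eqI)
    fix j
    have "(\<Sum>i\<in>UNIV. Poly_Mapping.lookup (Poly_Mapping.single i (Poly_Mapping.lookup a i)) j)
      = (\<Sum>i\<in>UNIV. if i = j then Poly_Mapping.lookup a j else 0)"
      by (intro sum.cong) (auto simp: lookup_single when_def)
    then show "Poly_Mapping.lookup (\<Sum>i\<in>UNIV. Poly_Mapping.single i (Poly_Mapping.lookup a i)) j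
      = Poly_Mapping.lookup a j" by (simp add: lookup_sum)
  qed
  then show ?thesis by (simp add: mvar_power prod mconst_def mult_single)
qed

lemma algebra_hom_monomial:
  fixes E :: "('n::finite, 'k::comm_ring_1) mpoly \<Rightarrow> ('m, 'k) mpoly"
  assumes "algebra_hom E"
  shows "E (Poly_Mapping.single a c) = mconst c * (\<Prod>i\<in>UNIV. E (mvar i) ^ Poly_Mapping.lookup a i)"
  using assms
  by (simp add: monomial_eq_prod algebra_hom_mult algebra_hom_mconst algebra_hom_prod algebra_hom_power)

lemma algebra_hom_eqI:
  fixes D E :: "('n::finite, 'k::comm_ring_1) mpoly \<Rightarrow> ('m, 'k) mpoly"
  assumes "algebra_hom D" "algebra_hom E" "\<And>i. D (mvar i) = E (mvar i)"
  shows "D p = E p"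
proof -
  have "D (Poly_Mapping.single a c) = E (Poly_Mapping.single a c)" for a c
    using assms by (simp add: algebra_hom_monomial)
  then show ?thesis
    using algebra_hom_sum[OF assms(1)] algebra_hom_sum[OF assms(2)]
    by (metis (no_types, lifting) mpoly_eq_sum_monomials sum.cong)
qed

definition subst_hom ::
    "('n::finite \<Rightarrow> ('m, 'k::comm_ring_1) mpoly) \<Rightarrow> ('n, 'k) mpoly \<Rightarrow> ('m, 'k) mpoly" where
  "subst_hom g p = (\<Sum>a\<in>Poly_Mapping.keys p.
     mconst (Poly_Mapping.lookup p a) * (\<Prod>i\<in>UNIV. g i ^ Poly_Mapping.lookup a i))"

lemma mconst_0 [simp]: "mconst 0 = 0"
  by (simp add: mconst_def)

lemma mconst_add: "mconst (c + d) = mconst c + mconst d"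
  by (simp add: mconst_def single_add)

lemma mconst_mult: "mconst (c * d) = mconst c * mconst d"
  by (simp add: mconst_def mult_single)

lemma subst_hom_single:
  "subst_hom g (Poly_Mapping.single a c) = mconst c * (\<Prod>i\<in>UNIV. g i ^ Poly_Mapping.lookup a i)"
  by (simp add: subst_hom_def)

lemma subst_hom_mvar [simp]: "subst_hom g (mvar i) = g i"
proof -
  have "(\<Prod>j\<in>UNIV. g j ^ Poly_Mapping.lookup (Poly_Mapping.single i 1) j) = (\<Prod>j\<in>UNIV. if j = i then g i else 1)"
    by (intro prod.cong) (auto simp: lookup_single when_def)
  then show ?thesis by (simp add: mvar_def subst_hom_single)
qed

lemma subst_hom_superset:
  assumes "finite K" "Poly_Mapping.keys p \<subseteq> K"
  shows "subst_hom g p = (\<Sum>a\<in>K.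
     mconst (Poly_Mapping.lookup p a) * (\<Prod>i\<in>UNIV. g i ^ Poly_Mapping.lookup a i))"
  unfolding subst_hom_def
  using assms by (intro sum.mono_neutral_left) (auto simp: in_keys_iff)

lemma subst_hom_add: "subst_hom g (p + q) = subst_hom g p + subst_hom g q"
proof -
  let ?K = "Poly_Mapping.keys p \<union> Poly_Mapping.keys q"
  show ?thesis
    using keys_add[of p q]
    by (simp add: subst_hom_superset[of ?K] lookup_add mconst_add distrib_right sum.distrib)
qed

lemma subst_hom_sum: "subst_hom g (sum f I) = (\<Sum>i\<in>I. subst_hom g (f i))"
  by (induction I rule: infinite_finite_induct)
    (simp_all add: subst_hom_add, simp_all add: subst_hom_def)

lemma algebra_hom_subst_hom:
  fixes g :: "'n::finite \<Rightarrow> ('m, 'k::comm_ring_1) mpoly"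
  shows "algebra_hom (subst_hom g)"
  unfolding algebra_hom_def
proof (intro conjI allI)
  show "subst_hom g (p + q) = subst_hom g p + subst_hom g q" for p q
    by (rule subst_hom_add)
  show "subst_hom g (mconst c) = mconst c" for c
    by (subst mconst_def) (simp add: subst_hom_single)
  have single: "subst_hom g (Poly_Mapping.single a c * Poly_Mapping.single b d)
      = subst_hom g (Poly_Mapping.single a c) * subst_hom g (Poly_Mapping.single b d)" for a b c d
    by (simp add: mult_single subst_hom_single lookup_add power_add prod.distrib mconst_mult mult_ac)
  fix p q :: "('n, 'k) mpoly"
  let ?m = "\<lambda>r a. Poly_Mapping.single a (Poly_Mapping.lookup r a)"
  have "p * q = (\<Sum>a\<in>Poly_Mapping.keys p. \<Sum>b\<in>Poly_Mapping.keys q. ?m p a * ?m q b)"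
    by (simp flip: sum_product mpoly_eq_sum_monomials)
  then have "subst_hom g (p * q)
      = subst_hom g (\<Sum>a\<in>Poly_Mapping.keys p. ?m p a) * subst_hom g (\<Sum>b\<in>Poly_Mapping.keys q. ?m q b)"
    by (simp add: subst_hom_sum single sum_product)
  then show "subst_hom g (p * q) = subst_hom g p * subst_hom g q"
    by (simp flip: mpoly_eq_sum_monomials)
qed

section \<open>The leading part of a homomorphism\<close>

text \<open>
  A homomorphism that does not raise the degrees of the variables raises no degrees, by
  multiplicativity; and its leading part is again a homomorphism, determined by the leading parts of
  the images of the variables. The parts of degree \<open>w l\<close> may vanish, and so may the part of degree
  \<open>d\<close>: the second claim concerns the bounds, not the actual degrees.
\<close>

lemma algebra_hom_leading_part:
  fixes w :: "'n::finite \<Rightarrow> 'g::linordered_ab_group_add" and v :: "'m::finite \<Rightarrow> 'g"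
    and E \<phi> :: "('n, 'k::comm_ring_1) mpoly \<Rightarrow> ('m, 'k) mpoly"
  assumes E: "algebra_hom E" and \<phi>: "algebra_hom \<phi>"
    and le: "\<And>l. wdeg_at_most v (w l) (E (mvar l))"
    and lead: "\<And>l. \<phi> (mvar l) = homog_part v (w l) (E (mvar l))"
    and p: "wdeg_at_most w d p"
  shows "wdeg_at_most v d (E p)" and "homog_part v d (E p) = \<phi> (homog_part w d p)"
proof -
  have mono: "wdeg_at_most v (wdeg_monomial w a) (E (Poly_Mapping.single a c)) \<and>
      homog_part v (wdeg_monomial w a) (E (Poly_Mapping.single a c)) = \<phi> (Poly_Mapping.single a c)"
    for a c
  proof -
    let ?f = "\<lambda>i. E (mvar i) ^ Poly_Mapping.lookup a i"
    have "wdeg_at_most v (wdeg_monomial w a) (prod ?f UNIV) \<and>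
      homog_part v (wdeg_monomial w a) (prod ?f UNIV)
        = (\<Prod>i\<in>UNIV. homog_part v (nat_scale (Poly_Mapping.lookup a i) (w i)) (?f i))"
      unfolding wdeg_monomial_def
      using homog_part_power[OF le] by (intro homog_part_prod) auto
    moreover have "homog_part v (nat_scale (Poly_Mapping.lookup a i) (w i)) (?f i)
        = \<phi> (mvar i) ^ Poly_Mapping.lookup a i" for i
      using homog_part_power[OF le] lead by simp
    ultimately show ?thesis
      using wdeg_at_most_mult[of v 0 "mconst c" "wdeg_monomial w a" "prod ?f UNIV"]
        homog_part_mult[of v 0 "mconst c" "wdeg_monomial w a" "prod ?f UNIV"]
      by (simp add: algebra_hom_monomial E \<phi>)
  qed
  have "wdeg_at_most v d (E (Poly_Mapping.single a c)) \<and>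
      homog_part v d (E (Poly_Mapping.single a c)) = \<phi> (homog_part w d (Poly_Mapping.single a c))"
    if "wdeg_monomial w a \<le> d" for a c
  proof (cases "wdeg_monomial w a = d")
    case True
    then have "homog_part w d (Poly_Mapping.single a c) = Poly_Mapping.single a c"
      by (intro homog_part_eq_self) (auto split: if_splits)
    then show ?thesis using mono[of a c] True by simp
  next
    case False
    then have "homog_part w d (Poly_Mapping.single a c) = 0"
      by (intro homog_part_eq_0) (auto split: if_splits)
    moreover have "homog_part v d (E (Poly_Mapping.single a c)) = 0"
      using mono[of a c] that False by (intro homog_part_eq_0) (force simp: wdeg_at_most_def)
    ultimately show ?thesis
      using mono[of a c] that by (auto simp: wdeg_at_most_def algebra_hom_0[OF \<phi>] intro: order_trans)
  qed
  moreover have "wdeg_monomial w a \<le> d" if "a \<in> Poly_Mapping.keys p" for a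
    using p that by (simp add: wdeg_at_most_def)
  ultimately have *: "wdeg_at_most v d (E (Poly_Mapping.single a c)) \<and>
      homog_part v d (E (Poly_Mapping.single a c)) = \<phi> (homog_part w d (Poly_Mapping.single a c))"
    if "a \<in> Poly_Mapping.keys p" for a c using that by blast
  have Ep: "E p = (\<Sum>a\<in>Poly_Mapping.keys p. E (Poly_Mapping.single a (Poly_Mapping.lookup p a)))"
    by (subst mpoly_eq_sum_monomials) (rule algebra_hom_sum[OF E])
  then show "wdeg_at_most v d (E p)" using * by (simp add: wdeg_at_most_sum)
  have "\<phi> (homog_part w d p) = (\<Sum>a\<in>Poly_Mapping.keys p.
      \<phi> (homog_part w d (Poly_Mapping.single a (Poly_Mapping.lookup p a))))"
    by (subst mpoly_eq_sum_monomials[of p]) (simp add: homog_part_sum algebra_hom_sum[OF \<phi>])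
  then show "homog_part v d (E p) = \<phi> (homog_part w d p)"
    using * by (simp add: Ep homog_part_sum)
qed

text \<open>
  For nonnegative weights this is the substitution of \<open>0\<close> for the variables of positive weight. It
  is multiplicative because degree \<open>0\<close> is the highest degree for the opposite weights.
\<close>

lemma algebra_hom_homog_part_0:
  fixes v :: "'n::finite \<Rightarrow> 'g::linordered_ab_group_add"
  assumes v: "\<And>i. 0 \<le> v i"
  shows "algebra_hom (homog_part v 0 :: ('n, 'k::comm_ring_1) mpoly \<Rightarrow> _)"
proof -
  have eq: "homog_part v 0 p = homog_part (\<lambda>i. - v i) 0 p" for p :: "('n, 'k) mpoly"
    by (rule poly_mapping_eqI) (simp add: lookup_homog_part wdeg_monomial_uminus)
  have le: "wdeg_at_most (\<lambda>i. - v i) 0 p" for p :: "('n, 'k) mpoly"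
    using wdeg_monomial_nonneg[of v, OF v] by (simp add: wdeg_at_most_def wdeg_monomial_uminus)
  have "homog_part v 0 (p * q) = homog_part v 0 p * homog_part v 0 q" for p q :: "('n, 'k) mpoly"
    using homog_part_mult[OF le[of p] le[of q]] by (simp add: eq)
  then show ?thesis by (simp add: algebra_hom_def homog_part_add)
qed

section \<open>Adjoining a variable\<close>

text \<open>
  The ring \<open>k[x][t]\<close> is the polynomial ring over the index type \<open>'n option\<close>, with \<open>t\<close> at index
  \<open>None\<close>. The weighted degree for \<open>new_weight\<close> is the degree in \<open>t\<close>.
\<close>

definition lift_hom :: "('n::finite, 'k::comm_ring_1) mpoly \<Rightarrow> ('n option, 'k) mpoly" where
  "lift_hom = subst_hom (\<lambda>i. mvar (Some i))"

abbreviation new_var :: "('n option, 'k::comm_ring_1) mpoly" where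
  "new_var \<equiv> mvar None"

abbreviation new_weight :: "'n option \<Rightarrow> int" where
  "new_weight \<equiv> \<lambda>j. of_bool (j = None)"

lemma algebra_hom_lift_hom: "algebra_hom lift_hom"
  by (simp add: lift_hom_def algebra_hom_subst_hom)

lemma lift_hom_mvar [simp]: "lift_hom (mvar i) = mvar (Some i)"
  by (simp add: lift_hom_def)

lemma algebra_hom_ident: "algebra_hom (\<lambda>p. p)"
  by (simp add: algebra_hom_def)

lemma lift_hom_eq_0_iff: "lift_hom p = 0 \<longleftrightarrow> p = 0"
proof
  let ?lower = "subst_hom (case_option 0 mvar)"
  have "?lower (lift_hom p) = p"
    by (rule algebra_hom_eqI[OF algebra_hom_comp[OF algebra_hom_subst_hom algebra_hom_lift_hom]
          algebra_hom_ident]) simp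
  moreover assume "lift_hom p = 0"
  ultimately show "p = 0" by (simp add: subst_hom_def)
qed (simp add: algebra_hom_0 algebra_hom_lift_hom)

lemma
  fixes v :: "'n::finite option \<Rightarrow> 'g::linordered_ab_group_add"
  assumes "wdeg_at_most (\<lambda>l. v (Some l)) d p"
  shows wdeg_at_most_lift_hom: "wdeg_at_most v d (lift_hom p)"
    and homog_part_lift_hom: "homog_part v d (lift_hom p) = lift_hom (homog_part (\<lambda>l. v (Some l)) d p)"
  using algebra_hom_leading_part[OF algebra_hom_lift_hom algebra_hom_lift_hom _ _ assms]
  by (simp_all add: homog_part_mvar)

lemma wdeg_lift_hom:
  fixes v :: "'n::finite option \<Rightarrow> 'g::linordered_ab_group_add"
  assumes "p \<noteq> 0"
  shows "wdeg v (lift_hom p) = wdeg (\<lambda>l. v (Some l)) p"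
  using assms
  by (intro wdeg_eqI)
    (simp_all add: wdeg_at_most_lift_hom homog_part_lift_hom wdeg_at_most_wdeg lift_hom_eq_0_iff
      homog_part_wdeg_nonzero)

lemma wdeg_at_most_new_weight_lift_hom: "wdeg_at_most new_weight 0 (lift_hom p)"
  by (rule wdeg_at_most_lift_hom) (simp add: wdeg_at_most_def wdeg_monomial_def)

lemma homog_part_new_weight_lift_hom [simp]:
  "homog_part new_weight 0 (lift_hom p) = lift_hom p"
  by (simp add: homog_part_0_eq_self wdeg_at_most_new_weight_lift_hom)

lemma wdeg_monomial_option:
  fixes v :: "'n::finite option \<Rightarrow> 'g::linordered_ab_group_add"
  shows "wdeg_monomial v b = nat_scale (Poly_Mapping.lookup b None) (v None)
    + (\<Sum>l\<in>UNIV. nat_scale (Poly_Mapping.lookup b (Some l)) (v (Some l)))"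
  by (simp add: wdeg_monomial_def UNIV_option_conv sum.reindex)

lemma algebra_hom_inv:
  assumes "algebra_automorphism F"
  shows "algebra_hom (inv F)"
proof -
  have bij: "bij F" and F: "algebra_hom F"
    using assms by (auto simp: algebra_automorphism_def algebra_hom_def)
  have inv: "inv F q = p" if "q = F p" for p q
    using that bij by (simp add: bij_is_inj)
  have surj: "F (inv F p) = p" for p
    using bij by (simp add: bij_is_surj surj_f_inv_f)
  show ?thesis
    unfolding algebra_hom_def
    by (intro conjI allI inv)
      (simp_all add: algebra_hom_add[OF F] algebra_hom_mult[OF F] algebra_hom_mconst[OF F] surj)
qed

section \<open>Degeneration of a translation\<close>

text \<open>
  The homomorphism \<open>\<phi>\<close> is the leading part of the translation that adds \<open>t\<close> to the \<open>i\<close>-th coordinate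
  \<open>F x\<^sub>i\<close> and fixes the other ones. The homogeneous part of degree \<open>0\<close> for \<open>new_weight\<close> is the
  specialization at \<open>t = 0\<close>, so the second property says that \<open>\<phi>\<close> deforms the inclusion.
\<close>

lemma translation_degeneration:
  fixes F :: "('n::finite, 'k::idom) mpoly \<Rightarrow> ('n, 'k) mpoly"
    and w :: "'n \<Rightarrow> 'g::linordered_ab_group_add" and i :: 'n
  assumes F: "algebra_automorphism F"
  defines "lead \<equiv> \<lambda>j. homog_part w (wdeg w (F (mvar j))) (F (mvar j))"
  obtains \<phi> :: "('n, 'k) mpoly \<Rightarrow> ('n option, 'k) mpoly" and l where
    "algebra_hom \<phi>"
    "\<And>p. homog_part new_weight 0 (\<phi> p) = lift_hom p"
    "\<phi> (mvar l) \<noteq> lift_hom (mvar l)"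
    "\<And>j. j \<noteq> i \<Longrightarrow> \<phi> (lead j) = lift_hom (lead j)"
    "\<phi> (lead i) = lift_hom (lead i) \<or> \<phi> (lead i) = lift_hom (lead i) + new_var"
proof -
  define S where "S = subst_hom (\<lambda>j. lift_hom (F (mvar j)) + (if j = i then new_var else 0))"
  define E where "E = (\<lambda>p. S (inv F p))"
  have bij: "bij F" and F_hom: "algebra_hom F"
    using F by (auto simp: algebra_automorphism_def algebra_hom_def)
  have E: "algebra_hom E"
    unfolding E_def S_def by (rule algebra_hom_comp[OF algebra_hom_subst_hom algebra_hom_inv[OF F]])
  have E_F: "E (F (mvar j)) = lift_hom (F (mvar j)) + (if j = i then new_var else 0)" for j
    using bij by (simp add: E_def S_def bij_is_inj)
  have at_0: "algebra_hom (homog_part new_weight 0 :: ('n option, 'k) mpoly \<Rightarrow> _)"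
    by (rule algebra_hom_homog_part_0) simp
  have "homog_part new_weight 0 (S p) = lift_hom (F p)" for p
  proof (rule algebra_hom_eqI[OF algebra_hom_comp[OF at_0] algebra_hom_comp[OF algebra_hom_lift_hom F_hom]])
    show "algebra_hom S" by (simp add: S_def algebra_hom_subst_hom)
    show "homog_part new_weight 0 (S (mvar j)) = lift_hom (F (mvar j))" for j
      by (simp add: S_def homog_part_add homog_part_mvar)
  qed
  then have E_0: "homog_part new_weight 0 (E p) = lift_hom p" for p
    using bij by (simp add: E_def bij_is_surj surj_f_inv_f)

  \<comment> \<open>A monomial \<open>x\<^sup>a t\<^sup>m\<close> of \<open>E x\<^sub>l\<close> with \<open>m > 0\<close> allows \<open>t\<close> at most the weight \<open>(w\<^sub>l - deg x\<^sup>a) / m\<close>.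
    Let \<open>K\<close> index these monomials, and let \<open>r\<close> be the degree in \<open>x\<close> alone.\<close>
  define r where "r b = (\<Sum>l\<in>UNIV. nat_scale (Poly_Mapping.lookup b (Some l)) (w l))"
    for b :: "'n option \<Rightarrow>\<^sub>0 nat"
  define K where "K = (SIGMA l:UNIV. {b \<in> Poly_Mapping.keys (E (mvar l)). 0 < Poly_Mapping.lookup b None})"
  have "K \<noteq> {}"
  proof
    assume "K = {}"
    then have "homog_part new_weight 0 (E (mvar l)) = E (mvar l)" for l
      unfolding K_def by (intro homog_part_eq_self) (fastforce simp: wdeg_monomial_of_bool)
    then have "E (mvar l) = lift_hom (mvar l)" for l
      using E_0[of "mvar l"] by simp
    then have "E (F (mvar i)) = lift_hom (F (mvar i))"
      by (rule algebra_hom_eqI[OF E algebra_hom_lift_hom])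
    then have "(new_var :: ('n option, 'k) mpoly) = 0" using E_F[of i] by simp
    then show False by (simp add: mvar_nonzero)
  qed
  moreover have "finite K" by (simp add: K_def)
  ultimately have "\<exists>(\<tau>, M)\<in>(\<lambda>(l, b). (w l - r b, Poly_Mapping.lookup b None)) ` K.
      \<forall>(u, m)\<in>(\<lambda>(l, b). (w l - r b, Poly_Mapping.lookup b None)) ` K. nat_scale m \<tau> \<le> nat_scale M u"
    by (intro finite_fractions_minimal) (auto simp: K_def)
  then obtain l0 b0 where K0: "(l0, b0) \<in> K" and min: "\<And>l b. (l, b) \<in> K \<Longrightarrow>
      nat_scale (Poly_Mapping.lookup b None) (w l0 - r b0)
        \<le> nat_scale (Poly_Mapping.lookup b0 None) (w l - r b)"
    by fastforce
  \<comment> \<open>The optimal weight of \<open>t\<close> is \<open>(w\<^sub>l - r b) / M\<close> at the minimizing pair \<open>(l0, b0)\<close>. Multiplying all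
    weights by \<open>M\<close> clears the denominator and, \<open>\<Gamma>\<close> being torsion-free, keeps all leading parts.\<close>
  define M where "M = Poly_Mapping.lookup b0 None"
  define v where "v = case_option (w l0 - r b0) (\<lambda>l. nat_scale M (w l))"
  have M: "0 < M" using K0 by (simp add: K_def M_def)
  have v: "wdeg_monomial v b = nat_scale (Poly_Mapping.lookup b None) (w l0 - r b0) + nat_scale M (r b)"
    for b
    by (simp add: wdeg_monomial_option v_def r_def nat_scale_sum nat_scale_left_commute[of M])
  have split: "nat_scale M (w l - r b) + nat_scale M (r b) = nat_scale M (w l)" for l b
    by (simp flip: nat_scale_add_right)
  have E_le: "wdeg_at_most v (nat_scale M (w l)) (E (mvar l))" for l
    unfolding wdeg_at_most_def
  proof
    fix b assume b: "b \<in> Poly_Mapping.keys (E (mvar l))"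
    show "wdeg_monomial v b \<le> nat_scale M (w l)"
    proof (cases "Poly_Mapping.lookup b None = 0")
      case True
      \<comment> \<open>The only monomial of \<open>E x\<^sub>l\<close> without \<open>t\<close> is \<open>x\<^sub>l\<close>.\<close>
      then have "b \<in> Poly_Mapping.keys (homog_part new_weight 0 (E (mvar l)))"
        using b by (simp add: keys_homog_part wdeg_monomial_of_bool)
      then show ?thesis by (simp add: E_0 v_def)
    next
      case False
      then have "(l, b) \<in> K" using b by (simp add: K_def)
      then show ?thesis
        unfolding v using min split[of l b] add_right_mono by (metis M_def)
    qed
  qed

  define \<phi> where "\<phi> = subst_hom (\<lambda>l. homog_part v (nat_scale M (w l)) (E (mvar l)))"
  have \<phi>: "algebra_hom \<phi>" by (simp add: \<phi>_def algebra_hom_subst_hom)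
  have \<phi>_0: "homog_part new_weight 0 (\<phi> p) = lift_hom p" for p
  proof (rule algebra_hom_eqI[OF algebra_hom_comp[OF at_0 \<phi>] algebra_hom_lift_hom])
    show "homog_part new_weight 0 (\<phi> (mvar l)) = lift_hom (mvar l)" for l
      by (simp add: \<phi>_def homog_part_commute[of new_weight] E_0 homog_part_mvar v_def)
  qed
  \<comment> \<open>The minimizing monomial attains the degree bound, hence survives in \<open>\<phi>\<close>.\<close>
  have "b0 \<in> Poly_Mapping.keys (\<phi> (mvar l0))"
    using K0 split[of l0 b0] by (simp add: \<phi>_def keys_homog_part v K_def flip: M_def)
  moreover have "b0 \<noteq> Poly_Mapping.single (Some l0) 1"
    using M by (auto simp: M_def lookup_single)
  ultimately have nontrivial: "\<phi> (mvar l0) \<noteq> lift_hom (mvar l0)" by auto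
  have lead: "\<phi> (lead j) = lift_hom (lead j) + homog_part v (nat_scale M (wdeg w (F (mvar j))))
      (if j = i then new_var else 0)" for j
  proof -
    let ?f = "F (mvar j)" and ?W = "\<lambda>l. nat_scale M (w l)"
    let ?d = "nat_scale M (wdeg w ?f)"
    have le: "wdeg_at_most ?W ?d ?f"
      using wdeg_at_most_wdeg[of w ?f]
      by (simp add: wdeg_at_most_def wdeg_monomial_nat_scale nat_scale_mono)
    have eq: "homog_part ?W ?d ?f = lead j"
      by (rule poly_mapping_eqI)
        (simp add: lead_def lookup_homog_part wdeg_monomial_nat_scale nat_scale_eq_iff[OF M])
    have "homog_part v ?d (E ?f) = \<phi> (homog_part ?W ?d ?f)"
      by (rule algebra_hom_leading_part(2)[OF E \<phi> E_le _ le]) (simp add: \<phi>_def)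
    moreover have "homog_part v ?d (lift_hom ?f) = lift_hom (lead j)"
      using homog_part_lift_hom[of v ?d ?f] le eq by (simp add: v_def)
    ultimately show ?thesis by (simp add: eq E_F homog_part_add)
  qed
  show thesis
  proof (rule that[OF \<phi> \<phi>_0 nontrivial])
    show "\<phi> (lead j) = lift_hom (lead j)" if "j \<noteq> i" for j
      using lead[of j] that by simp
    show "\<phi> (lead i) = lift_hom (lead i) \<or> \<phi> (lead i) = lift_hom (lead i) + new_var"
      using lead[of i] by (simp add: homog_part_mvar)
  qed
qed

section \<open>Factors of leading parts\<close>

lemma
  fixes \<phi> :: "('n::finite, 'k::idom) mpoly \<Rightarrow> ('n option, 'k) mpoly"
  assumes \<phi>_0: "\<And>p. homog_part new_weight 0 (\<phi> p) = lift_hom p" and p: "p \<noteq> 0"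
  shows deformation_nonzero: "\<phi> p \<noteq> 0"
    and deformation_trivial: "wdeg new_weight (\<phi> p) \<le> 0 \<Longrightarrow> \<phi> p = lift_hom p"
proof -
  show nz: "\<phi> p \<noteq> 0"
    using p \<phi>_0[of p] lift_hom_eq_0_iff[of p] by auto
  show "\<phi> p = lift_hom p" if "wdeg new_weight (\<phi> p) \<le> 0"
    using that nz \<phi>_0[of p] homog_part_0_eq_self[of new_weight "\<phi> p"] by (simp add: wdeg_at_most_iff)
qed

text \<open>
  The degrees in \<open>t\<close> of \<open>\<phi> p\<close> and \<open>\<phi> q\<close> are nonnegative and add up to \<open>0\<close>. So \<open>\<phi> p\<close> does not
  involve \<open>t\<close>, and it equals its specialization at \<open>t = 0\<close>.
\<close>

lemma deformation_trivial_on_factor: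
  fixes \<phi> :: "('n::finite, 'k::idom) mpoly \<Rightarrow> ('n option, 'k) mpoly"
  assumes \<phi>: "algebra_hom \<phi>" and \<phi>_0: "\<And>p. homog_part new_weight 0 (\<phi> p) = lift_hom p"
    and nz: "p \<noteq> 0" "q \<noteq> 0" and fixed: "\<phi> (p * q) = lift_hom (p * q)"
  shows "\<phi> p = lift_hom p"
proof -
  note \<phi>nz = deformation_nonzero[OF \<phi>_0 nz(1)] deformation_nonzero[OF \<phi>_0 nz(2)]
  have "wdeg new_weight (\<phi> p) + wdeg new_weight (\<phi> q) = wdeg new_weight (lift_hom (p * q))"
    using fixed by (simp add: algebra_hom_mult[OF \<phi>] wdeg_mult[OF \<phi>nz, symmetric])
  also have "\<dots> \<le> 0"
    using wdeg_at_most_new_weight_lift_hom[of "p * q"] mpoly_mult_nonzero[OF nz]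
    by (simp add: wdeg_at_most_iff lift_hom_eq_0_iff)
  finally have "wdeg new_weight (\<phi> p) \<le> 0"
    using wdeg_nonneg[of new_weight, OF _ \<phi>nz(2)] by simp
  then show ?thesis by (rule deformation_trivial[OF \<phi>_0 nz(1)])
qed

text \<open>
  The degree in \<open>t\<close> of \<open>\<phi> p * \<phi> q\<close> is \<open>1\<close>, and \<open>\<phi> p\<close> involves \<open>t\<close>. Hence \<open>\<phi> q\<close> does not,
  that is, \<open>\<phi> q = q\<close>. The part of degree \<open>1\<close> in \<open>t\<close> of the product shows that \<open>q\<close> divides \<open>t\<close>;
  not involving \<open>t\<close>, it must be constant.
\<close>

lemma deformation_cofactor_constant:
  fixes \<phi> :: "('n::finite, 'k::idom) mpoly \<Rightarrow> ('n option, 'k) mpoly"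
  assumes \<phi>: "algebra_hom \<phi>" and \<phi>_0: "\<And>p. homog_part new_weight 0 (\<phi> p) = lift_hom p"
    and nz: "p \<noteq> 0" "q \<noteq> 0" and nontrivial: "\<phi> p \<noteq> lift_hom p"
    and translated: "\<phi> (p * q) = lift_hom (p * q) + new_var"
  shows "Poly_Mapping.keys q \<subseteq> {0}"
proof -
  note \<phi>nz = deformation_nonzero[OF \<phi>_0 nz(1)] deformation_nonzero[OF \<phi>_0 nz(2)]
  have "wdeg_at_most new_weight 1 (lift_hom (p * q) + new_var)"
    using wdeg_at_most_new_weight_lift_hom[of "p * q"]
    by (intro wdeg_at_most_add) (auto simp: wdeg_at_most_def wdeg_monomial_of_bool)
  then have "wdeg new_weight (\<phi> p * \<phi> q) \<le> 1"
    using translated mpoly_mult_nonzero[OF \<phi>nz]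
    by (simp add: algebra_hom_mult[OF \<phi>] flip: wdeg_at_most_iff)
  then have sum: "wdeg new_weight (\<phi> p) + wdeg new_weight (\<phi> q) \<le> 1"
    by (simp add: wdeg_mult \<phi>nz)
  have pos: "1 \<le> wdeg new_weight (\<phi> p)"
    using deformation_trivial[OF \<phi>_0 nz(1)] nontrivial by linarith
  have \<phi>q: "\<phi> q = lift_hom q"
    using sum pos by (intro deformation_trivial[OF \<phi>_0 nz(2)]) linarith
  have "wdeg new_weight (\<phi> p) \<le> 1"
    using sum wdeg_nonneg[of new_weight, OF _ \<phi>nz(2)] by simp
  then have "homog_part new_weight (1 + 0) (\<phi> p * lift_hom q) = homog_part new_weight 1 (\<phi> p) * lift_hom q"
    using wdeg_at_most_new_weight_lift_hom[of q] \<phi>nz(1)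
    by (subst homog_part_mult) (simp_all add: wdeg_at_most_iff)
  moreover have "homog_part new_weight 1 (lift_hom (p * q)) = 0"
    using wdeg_at_most_new_weight_lift_hom[of "p * q"]
    by (intro homog_part_eq_0) (force simp: wdeg_at_most_def)
  then have "homog_part new_weight 1 (\<phi> (p * q)) = new_var"
    by (simp add: translated homog_part_add homog_part_mvar)
  ultimately have t: "new_var = homog_part new_weight 1 (\<phi> p) * lift_hom q" (is "_ = ?a * _")
    by (simp add: algebra_hom_mult[OF \<phi>] \<phi>q)
  \<comment> \<open>For the total degree in the variables other than \<open>t\<close>, the product has degree \<open>0\<close>.\<close>
  let ?u = "\<lambda>j::'n option. of_bool (j \<noteq> None) :: int"
  have "(new_var :: ('n option, 'k) mpoly) \<noteq> 0"
    by (rule mvar_nonzero)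
  then have a: "?a \<noteq> 0" using t by auto
  have q: "lift_hom q \<noteq> 0" using nz by (simp add: lift_hom_eq_0_iff)
  have "wdeg ?u (new_var :: ('n option, 'k) mpoly) = 0"
    by (simp add: wdeg_def)
  then have "wdeg ?u ?a + wdeg ?u (lift_hom q) = 0"
    using t wdeg_mult[OF a q, of ?u] by simp
  then have "wdeg ?u (lift_hom q) \<le> 0"
    using wdeg_nonneg[of ?u, OF _ a] by simp
  then have "wdeg (\<lambda>_. 1 :: int) q \<le> 0" using wdeg_lift_hom[OF nz(2), of ?u] by simp
  then have "wdeg_monomial (\<lambda>_. 1 :: int) a \<le> 0" if "a \<in> Poly_Mapping.keys q" for a
    using wdeg_monomial_le_wdeg[OF that, of "\<lambda>_. 1 :: int"] by linarith
  then have "(\<Sum>i\<in>UNIV. Poly_Mapping.lookup a i) = 0" if "a \<in> Poly_Mapping.keys q" for a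
    using that by (fastforce simp: wdeg_monomial_def simp flip: of_nat_sum)
  then show ?thesis by (auto intro!: poly_mapping_eqI)
qed

lemma mvar_dvd:
  assumes "\<And>a. a \<in> Poly_Mapping.keys p \<Longrightarrow> 0 < Poly_Mapping.lookup a l"
  obtains q where "p = mvar l * q"
proof -
  let ?s = "Poly_Mapping.single l 1"
  have shift: "?s + (a - ?s) = a" if "a \<in> Poly_Mapping.keys p" for a
    using assms[OF that] by (intro poly_mapping_eqI) (auto simp: lookup_add lookup_minus lookup_single when_def)
  have "mvar l * (\<Sum>a\<in>Poly_Mapping.keys p. Poly_Mapping.single (a - ?s) (Poly_Mapping.lookup p a))
      = (\<Sum>a\<in>Poly_Mapping.keys p. Poly_Mapping.single a (Poly_Mapping.lookup p a))"
    unfolding sum_distrib_left mvar_def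
    by (intro sum.cong) (simp_all add: mult_single shift[simplified])
  also have "\<dots> = p" by (rule mpoly_eq_sum_monomials[symmetric])
  finally show thesis using that by metis
qed

lemma wdeg_monomial_in_nat_span_except:
  assumes "Poly_Mapping.lookup a l = 0"
  shows "wdeg_monomial w a \<in> nat_span_except w l"
proof -
  have "wdeg_monomial w a = (\<Sum>i\<in>UNIV - {l}. nat_scale (Poly_Mapping.lookup a i) (w i))"
    unfolding wdeg_monomial_def by (intro sum.mono_neutral_right) (auto simp: assms)
  then show ?thesis unfolding nat_span_except_def by blast
qed

lemma leading_part_mvar_dvd:
  assumes "wdeg w f \<notin> nat_span_except w l"
  obtains q where "homog_part w (wdeg w f) f = mvar l * q"
proof (rule mvar_dvd)
  show "0 < Poly_Mapping.lookup a l" if "a \<in> Poly_Mapping.keys (homog_part w (wdeg w f) f)" for a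
    using that assms wdeg_monomial_in_nat_span_except[of a l w] by (auto simp: keys_homog_part)
qed

text \<open>
  The index \<open>l\<close> is that of a variable moved by the degeneration \<open>\<phi>\<close> of the \<open>i\<close>-th translation.
  A leading part divisible by this variable cannot be fixed by \<open>\<phi>\<close>, so it must be that of \<open>F x\<^sub>i\<close>,
  and then it is a constant multiple of the variable.
\<close>

lemma variable_moved_by_translation:
  fixes F :: "('n::finite, 'k::idom) mpoly \<Rightarrow> ('n, 'k) mpoly"
    and w :: "'n \<Rightarrow> 'g::linordered_ab_group_add" and i :: 'n
  assumes F: "algebra_automorphism F"
  shows "\<exists>l. (\<forall>j. j \<noteq> i \<longrightarrow> wdeg w (F (mvar j)) \<in> nat_span_except w l) \<and>
    (wdeg w (F (mvar i)) \<in> nat_span_except w l \<or> wdeg w (F (mvar i)) = w l)"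
proof -
  define lead where "lead \<equiv> \<lambda>j. homog_part w (wdeg w (F (mvar j))) (F (mvar j))"
  obtain \<phi> l where \<phi>: "algebra_hom \<phi>" "\<And>p. homog_part new_weight 0 (\<phi> p) = lift_hom p"
    and nontrivial: "\<phi> (mvar l) \<noteq> lift_hom (mvar l)"
    and fixed: "\<And>j. j \<noteq> i \<Longrightarrow> \<phi> (lead j) = lift_hom (lead j)"
    and moved: "\<phi> (lead i) = lift_hom (lead i) \<or> \<phi> (lead i) = lift_hom (lead i) + new_var"
    using translation_degeneration[OF F, of i w] unfolding lead_def by blast
  have lead_nz: "lead j \<noteq> 0" for j
  proof -
    have "F (mvar j) \<noteq> F 0"
      using F mvar_nonzero by (metis algebra_automorphism_def bij_is_inj injD)
    moreover have "F 0 = 0"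
      using F by (intro algebra_hom_0) (simp add: algebra_automorphism_def algebra_hom_def)
    ultimately show ?thesis by (simp add: lead_def homog_part_wdeg_nonzero)
  qed
  have split: "\<exists>q. lead j = mvar l * q \<and> q \<noteq> 0"
    if j: "wdeg w (F (mvar j)) \<notin> nat_span_except w l" for j
  proof -
    obtain q where "lead j = mvar l * q"
      using leading_part_mvar_dvd[OF j] unfolding lead_def .
    then show ?thesis using lead_nz[of j] by auto
  qed
  have not_fixed: "\<phi> (lead j) \<noteq> lift_hom (lead j)"
    if "wdeg w (F (mvar j)) \<notin> nat_span_except w l" for j
    using split[OF that] deformation_trivial_on_factor[OF \<phi> mvar_nonzero] nontrivial by metis
  have "wdeg w (F (mvar i)) = w l" if i: "wdeg w (F (mvar i)) \<notin> nat_span_except w l"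
  proof -
    obtain q where q: "lead i = mvar l * q" "q \<noteq> 0"
      using split[OF i] by blast
    have "Poly_Mapping.keys q \<subseteq> {0}"
      using deformation_cofactor_constant[OF \<phi> mvar_nonzero q(2) nontrivial] moved not_fixed[OF i] q(1) by metis
    then have "Poly_Mapping.keys (lead i) \<subseteq> {Poly_Mapping.single l 1}"
      using keys_mult[of "mvar l" q] q(1) by fastforce
    moreover obtain a where "a \<in> Poly_Mapping.keys (lead i)"
      using lead_nz[of i] by fastforce
    ultimately have "Poly_Mapping.single l 1 \<in> Poly_Mapping.keys (lead i)" by blast
    then show ?thesis by (simp add: lead_def keys_homog_part)
  qed
  then show ?thesis using fixed not_fixed by blast
qed

section \<open>Degrees of an automorphism\<close>

theorem corollary1p2:
  fixes F :: "('n::finite, 'k::idom) mpoly \<Rightarrow> ('n, 'k) mpoly"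
    and w :: "'n \<Rightarrow> 'g::linordered_ab_group_add"
  assumes "algebra_automorphism F"
    and "wdeg_map w F > (\<Sum>i\<in>UNIV. w i)"
  shows "\<exists>i. \<forall>j. wdeg w (F (mvar j)) \<in> nat_span_except w i"
proof (rule ccontr)
  assume none: "\<not> ?thesis"
  obtain \<sigma> where others: "\<And>i j. j \<noteq> i \<Longrightarrow> wdeg w (F (mvar j)) \<in> nat_span_except w (\<sigma> i)"
    and own: "\<And>i. wdeg w (F (mvar i)) \<in> nat_span_except w (\<sigma> i) \<or> wdeg w (F (mvar i)) = w (\<sigma> i)"
    using variable_moved_by_translation[OF assms(1), where w = w] by metis
  have not_own: "wdeg w (F (mvar i)) \<notin> nat_span_except w (\<sigma> i)" for i
    using none others by metis
  then have "inj \<sigma>" using others by (metis injI)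
  then have "bij \<sigma>" by (simp add: bij_def finite_UNIV_inj_surj)
  then have "(\<Sum>i\<in>UNIV. w (\<sigma> i)) = (\<Sum>i\<in>UNIV. w i)"
    by (rule sum.reindex_bij_betw)
  moreover have "wdeg_map w F = (\<Sum>i\<in>UNIV. w (\<sigma> i))"
    using own not_own by (simp add: wdeg_map_def)
  ultimately show False using assms(2) by simp
qed

end
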